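(* Let $\lambda$ be a nonzero real number. For every integer $n\ge 0$, $$\frac{1}{1-y}HF_{n,\lambda}\Big(\frac{y}{1-y}\Big)=\frac{1}{(1-y)^{\lambda}}\sum_{k=0}^{\infty}y^{k}(k)_{n,\lambda}\big(H_{k,\lambda}+\log_{\lambda}(1-y)\big).$$ Equivalently, $$HF_{n,\lambda}(y)=(1+y)^{\lambda -1}\sum_{k=0}^{\infty}\Big(\frac{y}{1+y}\Big)^{k}(k)_{n,\lambda}\Big(H_{k,\lambda}+\log_{\lambda}\Big(\frac{1}{1+y}\Big)\Big).$$ Moreover, $$\frac{1}{(1-y)^{\lambda}}\bigg\{\bigg(y\frac{d}{dy}\bigg)_{n,\lambda}\Big(-\frac{\log_{\lambda}(1-y)}{1-y}\Big)+\log_{\lambda}(1-y)\bigg(y\frac{d}{dy}\bigg)_{n,\lambda}\frac{1}{1-y}\bigg\}=\frac{1}{1-y}HF_{n,\lambda}\Big(\frac{y}{1-y}\Big).$$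
   Context: Fix a nonzero real $\lambda$. All identities are identities of formal power series (in $y$ with real coefficients for the claim), with $(1+u)^{a}=\sum_{j\ge0}\binom{a}{j}u^{j}$. Notation: $(x)_{0,\lambda}=1$ and $(x)_{n,\lambda}=x(x-\lambda)\cdots(x-(n-1)\lambda)$ for $n\ge1$. For the operator $D=y\frac{d}{dy}$, $(D)_{0,\lambda}$ is the identity and $(D)_{n,\lambda}=D(D-\lambda)(D-2\lambda)\cdots(D-(n-1)\lambda)$. Degenerate logarithm: $\log_{\lambda}(1+t)=\frac{1}{\lambda}\big((1+t)^{\lambda}-1\big)$; thus $\log_\lambda\big(\frac{1}{1+y}\big)=\frac1\lambda\big((1+y)^{-\lambda}-1\big)$. Degenerate exponential: $e_{\lambda}(t)=(1+\lambda t)^{1/\lambda}=\sum_{n\ge0}(1)_{n,\lambda}\frac{t^{n}}{n!}$. Degenerate harmonic numbers $H_{n,\lambda}$: defined by $H_{0,\lambda}=0$ and $-\frac{\log_{\lambda}(1-t)}{1-t}=\sum_{n=1}^{\infty}H_{n,\lambda}t^{n}$. Degenerate harmonic-Fubini polynomials $HF_{n,\lambda}(x)$: defined by $$-\frac{\log_{\lambda}\big(1-x(e_{\lambda}(t)-1)\big)}{1-x(e_{\lambda}(t)-1)}=\sum_{n=1}^{\infty}HF_{n,\lambda}(x)\frac{t^{n}}{n!},$$ with the convention $HF_{0,\lambda}(x)=0$. *)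

theory Defs
  imports "HOL-Computational_Algebra.Computational_Algebra"
begin

unbundle fps_syntax

definition deg_falling :: "real \<Rightarrow> real \<Rightarrow> nat \<Rightarrow> real" where
  "deg_falling l x n = (\<Prod>i<n. x - real i * l)"

(* D (D - l) (D - 2 l) ... (D - (n-1) l) applied to f, where D = y d/dy is fps_XD;
   the rightmost factor acts first. *)
primrec deg_XD :: "real \<Rightarrow> nat \<Rightarrow> real fps \<Rightarrow> real fps" where
  "deg_XD l 0 f = f"
| "deg_XD l (Suc n) f = deg_XD l n (fps_XD f - fps_const (real n * l) * f)"

(* (1 + u)^a = \<Sum>j. (a choose j) u^j; meaningful only if u has zero constant term,
   since fps_compose ignores this side condition. *)
definition fps_pow1p :: "real \<Rightarrow> real fps \<Rightarrow> real fps" where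
  "fps_pow1p a u = fps_binomial a oo u"

(* log_l (1 + u), again for u with zero constant term. *)
definition deg_log1p :: "real \<Rightarrow> real fps \<Rightarrow> real fps" where
  "deg_log1p l u = fps_const (1 / l) * (fps_pow1p l u - 1)"

definition deg_exp :: "real \<Rightarrow> real fps" where
  "deg_exp l = fps_pow1p (1 / l) (fps_const l * fps_X)"

definition deg_harmonic_gf :: "real \<Rightarrow> real fps" where
  "deg_harmonic_gf l = - (deg_log1p l (- fps_X) / (1 - fps_X))"

definition deg_harmonic :: "real \<Rightarrow> nat \<Rightarrow> real" where
  "deg_harmonic l n = deg_harmonic_gf l $ n"

(* Embeds R[[t]] into R[x][[t]]. *)
definition fps_to_poly_fps :: "real fps \<Rightarrow> real poly fps" where
  "fps_to_poly_fps f = Abs_fps (\<lambda>n. [:f $ n:])"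

(* - log_l (1 - w) / (1 - w) at w = x (e_l(t) - 1), as a power series in t over R[x].
   It is written as a composition because R[x][[t]] has no division operation; see
   harmonic_fubini_gf_poly and harmonic_fubini_gf below. *)
definition harmonic_fubini_gf :: "real \<Rightarrow> real poly fps" where
  "harmonic_fubini_gf l =
     fps_to_poly_fps (deg_harmonic_gf l) oo
       (fps_const [:0, 1:] * fps_to_poly_fps (deg_exp l - 1))"

definition harmonic_fubini :: "real \<Rightarrow> nat \<Rightarrow> real poly" where
  "harmonic_fubini l n = smult (fact n) (harmonic_fubini_gf l $ n)"

lemma deg_harmonic_0: "deg_harmonic l 0 = 0"
  by (simp add: deg_harmonic_def deg_harmonic_gf_def deg_log1p_def fps_pow1p_def fps_divide_unit)

lemma deg_harmonic_gf_eq: "Abs_fps (deg_harmonic l) = - (deg_log1p l (- fps_X) / (1 - fps_X))"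
  by (simp add: deg_harmonic_def deg_harmonic_gf_def fps_eq_iff)

lemma harmonic_fubini_0: "harmonic_fubini l 0 = 0"
  using deg_harmonic_0[of l]
  by (simp add: harmonic_fubini_def harmonic_fubini_gf_def fps_to_poly_fps_def deg_harmonic_def)

lemma deg_exp_nth:
  assumes "l \<noteq> 0"
  shows "deg_exp l $ n = deg_falling l 1 n / fact n"
proof -
  have "deg_exp l $ n = ((1 / l) gchoose n) * l ^ n"
    by (simp add: deg_exp_def fps_pow1p_def fps_binomial_nth)
  also have "((1 / l) gchoose n) * l ^ n = (\<Prod>i<n. (1 / l - real i) * l) / fact n"
    by (simp add: gbinomial_prod_rev prod.distrib atLeast0LessThan)
  also have "(\<Prod>i<n. (1 / l - real i) * l) = deg_falling l 1 n"
    using assms by (auto simp: deg_falling_def left_diff_distrib intro: prod.cong)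
  finally show ?thesis .
qed

lemma fps_to_poly_fps_mult: "fps_to_poly_fps (f * g) = fps_to_poly_fps f * fps_to_poly_fps g"
proof -
  have c: "[:sum h A:] = (\<Sum>i\<in>A. [:h i:])" for h :: "nat \<Rightarrow> real" and A
    by (rule poly_eqI) (simp add: coeff_sum coeff_pCons split: nat.splits)
  show ?thesis by (auto simp: fps_to_poly_fps_def fps_eq_iff fps_mult_nth c intro!: sum.cong)
qed

lemma harmonic_fubini_gf_poly:
  defines "u \<equiv> \<lambda>l. fps_const [:0, 1:] * fps_to_poly_fps (deg_exp l - 1)"
  shows "harmonic_fubini_gf l * (1 - u l) = - (fps_to_poly_fps (deg_log1p l (- fps_X)) oo u l)"
proof -
  have u0: "u l $ 0 = 0"
    by (simp add: u_def fps_to_poly_fps_def deg_exp_def fps_pow1p_def)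
  have "deg_harmonic_gf l * (1 - fps_X) = - deg_log1p l (- fps_X)"
    by (simp add: deg_harmonic_gf_def fps_divide_unit mult.assoc inverse_mult_eq_1)
  then have "fps_to_poly_fps (deg_harmonic_gf l) * fps_to_poly_fps (1 - fps_X)
      = fps_to_poly_fps (- deg_log1p l (- fps_X))"
    by (simp flip: fps_to_poly_fps_mult)
  moreover have "fps_to_poly_fps (1 - fps_X) = 1 - fps_X"
    by (auto simp: fps_to_poly_fps_def fps_eq_iff one_pCons)
  moreover have "fps_to_poly_fps (- deg_log1p l (- fps_X)) = - fps_to_poly_fps (deg_log1p l (- fps_X))"
    by (auto simp: fps_to_poly_fps_def fps_eq_iff)
  ultimately have "(fps_to_poly_fps (deg_harmonic_gf l) * (1 - fps_X)) oo u l
      = - (fps_to_poly_fps (deg_log1p l (- fps_X)) oo u l)"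
    by (simp add: fps_compose_uminus)
  then show ?thesis
    using u0 by (simp add: fps_compose_mult_distrib fps_compose_sub_distrib
        harmonic_fubini_gf_def u_def)
qed

lemma harmonic_fubini_gf:
  fixes l x :: real
  defines "v \<equiv> fps_const x * (deg_exp l - 1)"
  shows "Abs_fps (\<lambda>n. poly (harmonic_fubini l n) x / fact n) = - (deg_log1p l (- v) / (1 - v))"
proof -
  have v0: "v $ 0 = 0"
    by (simp add: v_def deg_exp_def fps_pow1p_def)
  define ev :: "real poly fps \<Rightarrow> real fps" where "ev F = Abs_fps (\<lambda>n. poly (F $ n) x)" for F
  have ev_mult: "ev (F * G) = ev F * ev G" for F G
    by (simp add: ev_def fps_eq_iff fps_mult_nth poly_sum)
  have ev_one: "ev 1 = 1" by (simp add: ev_def fps_eq_iff)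
  have ev_pow: "ev (F ^ k) = ev F ^ k" for F k
    by (induction k) (simp_all add: ev_one ev_mult)
  have ev_nth: "poly (F $ n) x = ev F $ n" for F n by (simp add: ev_def)
  have ev_emb: "ev (fps_to_poly_fps f) = f" for f
    by (simp add: ev_def fps_to_poly_fps_def fps_eq_iff)
  have ev_c: "ev (fps_const [:0, 1:]) = fps_const x"
    by (simp add: ev_def fps_eq_iff)
  have comp: "ev (F oo G) = ev F oo ev G" for F G
    by (rule fps_ext)
      (simp add: ev_nth[symmetric] fps_compose_nth poly_sum, simp add: ev_nth ev_pow)
  have "Abs_fps (\<lambda>n. poly (harmonic_fubini l n) x / fact n) = ev (harmonic_fubini_gf l)"
    by (simp add: ev_def harmonic_fubini_def)
  also have "\<dots> = deg_harmonic_gf l oo v"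
    by (simp add: harmonic_fubini_gf_def comp ev_mult ev_emb ev_c v_def)
  also have "\<dots> = - ((deg_log1p l (- fps_X) oo v) / (1 - v))"
    using v0 by (simp add: deg_harmonic_gf_def fps_compose_uminus fps_divide_compose
        fps_compose_sub_distrib)
  also have "deg_log1p l (- fps_X) oo v = deg_log1p l (- v)"
    using v0 by (simp add: deg_log1p_def fps_pow1p_def fps_compose_mult_distrib
        fps_compose_sub_distrib fps_compose_assoc[symmetric] fps_compose_uminus)
  finally show ?thesis .
qed

end

theory Submission
  imports Defs
begin

text \<open>
  Write \<open>e\<close> for the degenerate exponential and \<open>h\<^sub>j\<close> for the degenerate harmonic numbers.
  Everything reduces to one elementary identity between binomial series, because each ingredient
  is linear in the sequence \<open>k \<mapsto> (k)\<^bsub>n,l\<^esub>\<close>, and this sequence is a combination of finitely many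
  binomial coefficients. Comparing coefficients of \<open>t^n\<close> in \<open>e^k = (1 + (e - 1))^k\<close> gives the
  Newton expansion \<open>(k)\<^bsub>n,l\<^esub> = (\<Sum>j\<le>n. c\<^sub>j (k choose j))\<close> with \<open>c\<^sub>j = n! [t^n] (e - 1)^j\<close>
  (\<open>deg_falling_eq_sum_gbinomial\<close>). The same numbers are the coefficients of the
  harmonic-Fubini polynomial, \<open>HF\<^sub>n(x) = (\<Sum>j\<le>n. c\<^sub>j h\<^sub>j x^j)\<close> (\<open>harmonic_fubini_eq_sum\<close>).
  So it suffices to prove, for each \<open>j\<close>,
  \<open>(\<Sum>k. y^k (k choose j) (h\<^sub>k + log(1 - y))) = (1 - y)^l h\<^sub>j y^j / (1 - y)^(j+1)\<close>.

  Here \<open>log(1 - y) = ((1 - y)^l - 1) / l\<close>, and the \<open>h\<^sub>k\<close> have generating function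
  \<open>((1 - y)^(-1) - (1 - y)^(l-1)) / l\<close>, a combination of powers of \<open>1 - y\<close>.
  Weighting the coefficients of \<open>(1 - y)^a\<close> by \<open>k choose j\<close> gives
  \<open>(-1)^j (a choose j) y^j (1 - y)^(a-j)\<close> (\<open>fps_weight_gbinomial_pow1p\<close>). In the sum of the two
  parts the terms without the factor \<open>(1 - y)^l\<close> cancel, and the remaining constant
  \<open>(1 - (-1)^j (l - 1 choose j)) / l\<close> is \<open>h\<^sub>j\<close> (\<open>gbinomial_weight_identity\<close>).

  The operator form is the same statement, since \<open>y d/dy\<close> multiplies the coefficient of \<open>y^k\<close>
  by \<open>k\<close>. The form without \<open>y / (1 - y)\<close> arises by the substitution \<open>y \<mapsto> y / (1 + y)\<close>, which
  inverts \<open>y \<mapsto> y / (1 - y)\<close>, turns \<open>1 - y\<close> into \<open>(1 + y)^(-1)\<close>, and may be applied termwise to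
  a convergent series of power series.
\<close>

section \<open>Binomial series\<close>

lemma fps_pow1p_nth_0 [simp]: "fps_pow1p a u $ 0 = 1"
  by (simp add: fps_pow1p_def)

lemma fps_pow1p_0 [simp]: "fps_pow1p 0 u = 1"
  by (simp add: fps_pow1p_def)

lemma fps_pow1p_add:
  assumes "u $ 0 = 0"
  shows "fps_pow1p (a + b) u = fps_pow1p a u * fps_pow1p b u"
  using assms by (simp add: fps_pow1p_def fps_binomial_add_mult fps_compose_mult_distrib)

lemma fps_pow1p_power:
  assumes "u $ 0 = 0"
  shows "fps_pow1p a u ^ k = fps_pow1p (real k * a) u"
  using assms by (simp add: fps_pow1p_def fps_compose_power fps_binomial_power)

lemma fps_pow1p_of_nat:
  assumes "u $ 0 = 0"
  shows "fps_pow1p (real k) u = (1 + u) ^ k"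
  using assms by (simp add: fps_pow1p_def fps_binomial_of_nat fps_compose_power[symmetric]
      fps_compose_add_distrib)

lemma fps_pow1p_minus:
  assumes "u $ 0 = 0"
  shows "fps_pow1p (- a) u = 1 / fps_pow1p a u"
proof -
  have "fps_pow1p (- a) u * fps_pow1p a u = 1"
    using fps_pow1p_add[OF assms, of "- a" a] by simp
  then have "inverse (fps_pow1p a u) = fps_pow1p (- a) u"
    by (intro fps_inverse_unique) (simp add: mult.commute)
  then show ?thesis by (simp add: fps_divide_unit)
qed

lemma fps_pow1p_uminus_X_nth: "fps_pow1p a (- fps_X) $ k = (- 1) ^ k * (a gchoose k)"
  by (simp add: fps_pow1p_def fps_compose_uminus')

lemma one_over_one_minus_X: "1 / (1 - fps_X) = fps_pow1p (- 1) (- fps_X)"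
  using fps_pow1p_of_nat[of "- fps_X" 1] by (simp add: fps_pow1p_minus)

lemma X_over_one_minus_X: "fps_X / (1 - fps_X) = fps_X * fps_pow1p (- 1) (- fps_X)"
  by (simp add: one_over_one_minus_X[symmetric] fps_divide_unit)

text \<open>Both sides solve \<open>(1 + y) f' = - a f\<close> with constant term 1.\<close>

lemma fps_pow1p_recip:
  "fps_pow1p a (1 / (1 + fps_X) - 1) = fps_pow1p (- a) fps_X"
proof -
  define u :: "real fps" where "u = 1 / (1 + fps_X) - 1"
  have u0: "u $ 0 = 0" by (simp add: u_def fps_divide_unit)
  have u1: "(1 + fps_X) oo u = inverse (1 + fps_X)"
    using u0 by (simp add: fps_compose_add_distrib) (simp add: u_def fps_divide_unit)
  have du: "fps_deriv u = - (inverse (1 + fps_X) ^ 2)"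
    by (simp add: u_def fps_divide_unit fps_inverse_deriv)
  have "fps_deriv (fps_binomial a oo u) = (fps_const a * fps_binomial a / (1 + fps_X) oo u) * fps_deriv u"
    using u0 by (simp add: fps_compose_deriv fps_binomial_deriv)
  also have "fps_const a * fps_binomial a / (1 + fps_X) oo u
      = fps_const a * (fps_binomial a oo u) * (1 + fps_X)"
    using u0 by (simp add: fps_divide_compose u1 fps_compose_mult_distrib)
      (simp add: fps_divide_unit)
  also have "\<dots> * fps_deriv u = fps_const (- a) * (fps_binomial a oo u) * inverse (1 + fps_X)
      * ((1 + fps_X) * inverse (1 + fps_X))"
    unfolding du power2_eq_square fps_const_neg[symmetric]
    by (simp only: mult_minus_left mult_minus_right mult_ac)
  also have "(1 + fps_X) * inverse (1 + fps_X) = (1 :: real fps)"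
    by (simp add: inverse_mult_eq_1')
  finally have "fps_deriv (fps_binomial a oo u) = fps_const (- a) * (fps_binomial a oo u) / (1 + fps_X)"
    by (simp add: fps_divide_unit)
  then have "fps_binomial a oo u = fps_binomial (- a)"
    by (subst fps_binomial_ODE_unique'[symmetric]) simp
  then show ?thesis by (simp add: fps_pow1p_def u_def)
qed

section \<open>Operators acting diagonally on the powers of the indeterminate\<close>

definition fps_weight :: "(nat \<Rightarrow> real) \<Rightarrow> real fps \<Rightarrow> real fps" where
  "fps_weight p f = Abs_fps (\<lambda>k. p k * f $ k)"

lemma fps_weight_nth [simp]: "fps_weight p f $ k = p k * f $ k"
  by (simp add: fps_weight_def)

lemma fps_weight_sum:
  "fps_weight (\<lambda>k. \<Sum>j\<in>A. c j * q j k) f = (\<Sum>j\<in>A. fps_const (c j) * fps_weight (q j) f)"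
  by (simp add: fps_eq_iff fps_sum_nth sum_distrib_right mult.assoc)

lemma deg_XD_eq_weight: "deg_XD l n f = fps_weight (\<lambda>k. deg_falling l (real k) n) f"
proof (induction n arbitrary: f)
  case (Suc n)
  then show ?case
    by (simp add: fps_eq_iff deg_falling_def algebra_simps fps_XD_def)
qed (simp_all add: fps_eq_iff deg_falling_def)

text \<open>In each coefficient the partial sums are eventually constant, as the \<open>k\<close>-th term is
  divisible by \<open>y^k\<close>. The part with \<open>L\<close> is the series \<open>\<Sum>k. p k y^k\<close>, which is the
  weighted geometric series, times \<open>L\<close>.\<close>

lemma sums_fps_weight:
  "(\<lambda>k. fps_X ^ k * fps_const (p k) * (fps_const (f $ k) + L))
     sums (fps_weight p f + L * fps_weight p (1 / (1 - fps_X)))"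
  unfolding sums_def
proof (rule tendsto_fpsI)
  fix m :: nat
  define T where "T k = fps_X ^ k * fps_const (p k) * (fps_const (f $ k) + L)" for k
  have one: "(1 / (1 - fps_X)) $ k = (1 :: real)" for k
    by (simp add: one_over_one_minus_X fps_pow1p_uminus_X_nth gbinomial_minus
        binomial_gbinomial[symmetric])
  have T: "T k $ i = (if i < k then 0 else p k * ((if i = k then f $ k else 0) + L $ (i - k)))" for k i
    by (auto simp: T_def mult.assoc fps_X_power_mult_nth)
  show "\<forall>\<^sub>F N in sequentially. (\<Sum>k<N. T k) $ m
      = (fps_weight p f + L * fps_weight p (1 / (1 - fps_X))) $ m"
    using eventually_gt_at_top[of m]
  proof eventually_elim
    case (elim N)
    have "(\<Sum>k<N. T k) $ m = (\<Sum>k\<le>m. T k $ m)"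
      unfolding fps_sum_nth by (rule sum.mono_neutral_right) (use elim in \<open>auto simp: T\<close>)
    also have "\<dots> = (\<Sum>k\<le>m. (if k = m then p m * f $ m else 0) + p k * L $ (m - k))"
      by (rule sum.cong) (auto simp: T algebra_simps)
    also have "\<dots> = p m * f $ m + (fps_weight p (1 / (1 - fps_X)) * L) $ m"
      by (simp add: sum.distrib fps_mult_nth one atLeast0AtMost)
    finally show ?case by (simp add: mult.commute)
  qed
qed

text \<open>Coefficient \<open>m\<close> of a composition depends only on the coefficients up to \<open>m\<close> of the outer
  series, so composition on the right is continuous.\<close>

lemma sums_fps_compose:
  fixes f :: "nat \<Rightarrow> real fps"
  assumes "f sums s"
  shows "(\<lambda>k. f k oo g) sums (s oo g)"
  unfolding sums_def
proof (rule tendsto_fpsI)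
  fix m :: nat
  have "\<forall>\<^sub>F N in sequentially. \<forall>i\<in>{0..m}. (\<Sum>k<N. f k) $ i = s $ i"
    using assms by (subst eventually_ball_finite_distrib) (auto simp: sums_def tendsto_fps_iff)
  then show "\<forall>\<^sub>F N in sequentially. (\<Sum>k<N. f k oo g) $ m = (s oo g) $ m"
    by eventually_elim (simp add: fps_compose_sum_distrib[symmetric] fps_compose_nth)
qed

text \<open>Weighting by \<open>k choose j\<close> is the operator \<open>y^j/j! (d/dy)^j\<close>, which takes a power of
  \<open>1 - y\<close> to a multiple of another one. On coefficients this is trinomial revision.\<close>

lemma fps_weight_gbinomial_pow1p:
  "fps_weight (\<lambda>k. real k gchoose j) (fps_pow1p a (- fps_X))
     = fps_const ((- 1) ^ j * (a gchoose j)) * (fps_X ^ j * fps_pow1p (a - real j) (- fps_X))"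
proof (rule fps_ext)
  fix k
  show "fps_weight (\<lambda>k. real k gchoose j) (fps_pow1p a (- fps_X)) $ k
      = (fps_const ((- 1) ^ j * (a gchoose j)) * (fps_X ^ j * fps_pow1p (a - real j) (- fps_X))) $ k"
  proof (cases "k < j")
    case True
    then show ?thesis
      by (simp add: fps_X_power_mult_nth binomial_gbinomial[symmetric])
  next
    case False
    then obtain d where k: "k = j + d" by (metis le_Suc_ex not_less)
    have "(a gchoose k) * (real k gchoose j) = (a gchoose j) * (a - real j gchoose (k - j))"
      by (rule gbinomial_trinomial_revision) (simp add: k)
    then show ?thesis
      by (simp add: fps_X_power_mult_nth fps_pow1p_uminus_X_nth k power_add mult_ac)
  qed
qed

section \<open>The harmonic-Fubini polynomials in the Newton basis\<close>

text \<open>Up to the factor \<open>j!\<close> these are the degenerate Stirling numbers of the second kind.\<close>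

definition fubini_coeff :: "real \<Rightarrow> nat \<Rightarrow> nat \<Rightarrow> real" where
  "fubini_coeff l n j = fact n * ((deg_exp l - 1) ^ j $ n)"

lemma deg_exp_nth_0: "deg_exp l $ 0 = 1"
  by (simp add: deg_exp_def)

text \<open>The \<open>k\<close>-th power of \<open>(1 + l t)^(1/l)\<close> is again a binomial series, now with exponent \<open>k/l\<close>.\<close>

lemma deg_exp_power_nth:
  assumes "l \<noteq> 0"
  shows "deg_exp l ^ k $ n = deg_falling l (real k) n / fact n"
proof -
  have "deg_exp l ^ k $ n = ((real k / l) gchoose n) * l ^ n"
    by (simp add: deg_exp_def fps_pow1p_power) (simp add: fps_pow1p_def)
  also have "\<dots> = (\<Prod>i<n. (real k / l - real i) * l) / fact n"
    by (simp add: gbinomial_prod_rev prod.distrib atLeast0LessThan)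
  also have "(\<Prod>i<n. (real k / l - real i) * l) = deg_falling l (real k) n"
    using assms by (auto simp: deg_falling_def left_diff_distrib intro: prod.cong)
  finally show ?thesis .
qed

text \<open>Compare coefficients in \<open>e^k = (1 + (e - 1))^k\<close>. Expanding the right-hand side as a
  binomial series composed with \<open>e - 1\<close>, and not as a finite power, gives a summation range that
  does not depend on \<open>k\<close>, as the linearity argument requires.\<close>

lemma deg_falling_eq_sum_gbinomial:
  assumes "l \<noteq> 0"
  shows "deg_falling l (real k) n = (\<Sum>j\<le>n. fubini_coeff l n j * (real k gchoose j))"
proof -
  have "deg_falling l (real k) n = fact n * (fps_pow1p (real k) (deg_exp l - 1) $ n)"
    using assms by (simp add: fps_pow1p_of_nat deg_exp_nth_0 deg_exp_power_nth)
  then show ?thesis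
    by (simp add: fps_pow1p_def fps_compose_nth fubini_coeff_def sum_distrib_left
        atLeast0AtMost mult_ac)
qed

text \<open>The generating function is \<open>\<Sum>j. h\<^sub>j x^j (e - 1)^j\<close>, and \<open>(e - 1)^j\<close> is divisible
  by \<open>t^j\<close>.\<close>

lemma harmonic_fubini_eq_sum:
  "harmonic_fubini l n = (\<Sum>j\<le>n. monom (fubini_coeff l n j * deg_harmonic l j) j)"
proof -
  have pow: "fps_to_poly_fps f ^ j = fps_to_poly_fps (f ^ j)" for f j
    by (induction j)
      (simp_all add: fps_to_poly_fps_mult, simp add: fps_to_poly_fps_def fps_eq_iff one_pCons)
  have "harmonic_fubini_gf l $ n
      = (\<Sum>j\<le>n. [:deg_harmonic l j:] * ([:0, 1:] ^ j * [:(deg_exp l - 1) ^ j $ n:]))"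
    by (simp add: harmonic_fubini_gf_def fps_compose_nth power_mult_distrib pow fps_const_power
        atLeast0AtMost del: fps_const_power mult_pCons_left mult_pCons_right)
      (simp add: fps_to_poly_fps_def deg_harmonic_def)
  also have "smult (fact n) \<dots> = (\<Sum>j\<le>n. monom (fubini_coeff l n j * deg_harmonic l j) j)"
    by (rule poly_eqI)
      (auto simp: coeff_sum sum_distrib_left fubini_coeff_def monom_altdef mult_ac intro!: sum.cong)
  finally show ?thesis by (simp add: harmonic_fubini_def)
qed

section \<open>The transformed series\<close>

lemma deg_harmonic_gf_eq_pow1p:
  "deg_harmonic_gf l
     = fps_const (1 / l) * (fps_pow1p (- 1) (- fps_X) - fps_pow1p (l - 1) (- fps_X))"
proof -
  have "deg_harmonic_gf l = - (deg_log1p l (- fps_X) * fps_pow1p (- 1) (- fps_X))"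
    by (simp add: deg_harmonic_gf_def one_over_one_minus_X[symmetric] fps_divide_unit)
  moreover have "fps_pow1p (l - 1) (- fps_X) = fps_pow1p l (- fps_X) * fps_pow1p (- 1) (- fps_X)"
    using fps_pow1p_add[of "- fps_X" l "- 1"] by simp
  ultimately show ?thesis
    by (simp add: deg_log1p_def algebra_simps)
qed

text \<open>With \<open>B a = (1 - y)^a\<close> and \<open>W\<close> the weighting by \<open>k choose j\<close>, the left-hand side is
  \<open>(W(B(-1)) - W(B(l - 1)) + (B l - 1) W(B(-1))) / l\<close>. The terms \<open>W(B(-1))\<close> without the factor
  \<open>B l\<close> cancel, and \<open>W(B(l - 1))\<close> is a multiple of \<open>B l W(B(-1))\<close>.\<close>

lemma gbinomial_weight_identity:
  "fps_weight (\<lambda>k. real k gchoose j) (deg_harmonic_gf l)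
     + deg_log1p l (- fps_X) * fps_weight (\<lambda>k. real k gchoose j) (1 / (1 - fps_X))
   = fps_pow1p l (- fps_X) * (1 / (1 - fps_X)
       * (fps_const (deg_harmonic l j) * (fps_X / (1 - fps_X)) ^ j))"
proof -
  define B where "B a = fps_pow1p a (- fps_X)" for a
  define W where "W = fps_weight (\<lambda>k. real k gchoose j)"
  define s where "s = (- 1) ^ j * (l - 1 gchoose j)"
  have B_add: "B (a + b) = B a * B b" for a b
    by (simp add: B_def fps_pow1p_add)
  have m1: "(- 1) ^ j * (- 1 gchoose j) = (1 :: real)"
    by (simp add: gbinomial_minus binomial_gbinomial[symmetric])
  have W_lin: "W (fps_const c * (f - g)) = fps_const c * (W f - W g)" for c f g
    by (simp add: W_def fps_eq_iff algebra_simps)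
  have W1: "W (B (- 1)) = fps_X ^ j * B (- 1 - real j)"
    using fps_weight_gbinomial_pow1p[of j "- 1"] by (simp add: W_def B_def m1)
  have W2: "W (B (l - 1)) = fps_const s * (fps_X ^ j * B (l - 1 - real j))"
    using fps_weight_gbinomial_pow1p[of j "l - 1"] by (simp add: W_def B_def s_def)
  have h: "deg_harmonic l j = 1 / l * (1 - s)"
    by (simp add: deg_harmonic_def deg_harmonic_gf_eq_pow1p fps_pow1p_uminus_X_nth m1 s_def)
  have B3: "B (l - 1 - real j) = B l * B (- 1 - real j)"
    using B_add[of l "- 1 - real j"] by (simp add: algebra_simps)
  have "W (deg_harmonic_gf l) + deg_log1p l (- fps_X) * W (B (- 1))
      = fps_const (1 / l) * (W (B (- 1)) - W (B (l - 1)))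
        + fps_const (1 / l) * (B l - 1) * W (B (- 1))"
    by (simp add: deg_harmonic_gf_eq_pow1p W_lin deg_log1p_def flip: B_def)
  also have "\<dots> = fps_const (1 / l) * (1 - fps_const s) * (B l * (fps_X ^ j * B (- 1 - real j)))"
    unfolding W1 W2 B3 by algebra
  also have "fps_const (1 / l) * (1 - fps_const s) = fps_const (deg_harmonic l j)"
    by (simp only: h fps_const_mult[symmetric] fps_const_sub[symmetric] fps_const_1_eq_1)
  also have "B (- 1 - real j) = B (- 1) * B (- 1) ^ j"
    using B_add[of "- 1" "- real j"] by (simp add: B_def fps_pow1p_power)
  finally show ?thesis
    unfolding X_over_one_minus_X unfolding one_over_one_minus_X B_def[symmetric] W_def[symmetric]
    by (simp only: power_mult_distrib mult_ac)
qed

text \<open>Both sides are the same linear combination, with the Newton coefficients of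
  \<open>(k)\<^bsub>n,l\<^esub>\<close>, of the two sides of the previous identity.\<close>

lemma deg_falling_weight_identity:
  assumes "l \<noteq> 0"
  shows "fps_weight (\<lambda>k. deg_falling l (real k) n) (deg_harmonic_gf l)
     + deg_log1p l (- fps_X) * fps_weight (\<lambda>k. deg_falling l (real k) n) (1 / (1 - fps_X))
   = fps_pow1p l (- fps_X) * (1 / (1 - fps_X)
       * (fps_of_poly (harmonic_fubini l n) oo (fps_X / (1 - fps_X))))"
proof -
  define c where "c = fubini_coeff l n"
  define W where "W j = fps_weight (\<lambda>k. real k gchoose j)" for j
  define z :: "real fps" where "z = fps_X / (1 - fps_X)"
  have z0: "z $ 0 = 0" by (simp add: z_def fps_divide_unit)
  have weight: "fps_weight (\<lambda>k. deg_falling l (real k) n) f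
      = (\<Sum>j\<le>n. fps_const (c j) * W j f)" for f
    by (simp add: deg_falling_eq_sum_gbinomial[OF assms] fps_weight_sum c_def W_def)
  have HF: "fps_of_poly (harmonic_fubini l n) oo z
      = (\<Sum>j\<le>n. fps_const (c j) * (fps_const (deg_harmonic l j) * z ^ j))"
    using z0 by (simp add: harmonic_fubini_eq_sum fps_of_poly_sum fps_of_poly_monom
        fps_compose_sum_distrib fps_compose_mult_distrib fps_compose_power[symmetric] c_def
        fps_const_mult[symmetric] mult.assoc del: fps_const_mult)
  have "(\<Sum>j\<le>n. fps_const (c j) * W j (deg_harmonic_gf l))
        + deg_log1p l (- fps_X) * (\<Sum>j\<le>n. fps_const (c j) * W j (1 / (1 - fps_X)))
      = (\<Sum>j\<le>n. fps_const (c j)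
          * (W j (deg_harmonic_gf l) + deg_log1p l (- fps_X) * W j (1 / (1 - fps_X))))"
    by (simp only: sum_distrib_left sum.distrib[symmetric] distrib_left mult.left_commute)
  also have "\<dots> = fps_pow1p l (- fps_X) * (1 / (1 - fps_X)
       * (\<Sum>j\<le>n. fps_const (c j) * (fps_const (deg_harmonic l j) * z ^ j)))"
    unfolding W_def gbinomial_weight_identity z_def[symmetric]
    by (simp only: sum_distrib_left mult.left_commute)
  finally show ?thesis
    unfolding weight z_def[symmetric] HF .
qed

theorem theorem4:
  fixes l :: real and n :: nat
  assumes "l \<noteq> 0"
  shows
    "summable (\<lambda>k. fps_X ^ k * fps_const (deg_falling l (real k) n) *
        (fps_const (deg_harmonic l k) + deg_log1p l (- fps_X)))
     \<and> 1 / (1 - fps_X) * (fps_of_poly (harmonic_fubini l n) oo (fps_X / (1 - fps_X)))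
       = 1 / fps_pow1p l (- fps_X) *
         (\<Sum>k. fps_X ^ k * fps_const (deg_falling l (real k) n) *
            (fps_const (deg_harmonic l k) + deg_log1p l (- fps_X)))
     \<and> summable (\<lambda>k. (fps_X / (1 + fps_X)) ^ k * fps_const (deg_falling l (real k) n) *
        (fps_const (deg_harmonic l k) + deg_log1p l (1 / (1 + fps_X) - 1)))
     \<and> fps_of_poly (harmonic_fubini l n)
       = fps_pow1p (l - 1) fps_X *
         (\<Sum>k. (fps_X / (1 + fps_X)) ^ k * fps_const (deg_falling l (real k) n) *
            (fps_const (deg_harmonic l k) + deg_log1p l (1 / (1 + fps_X) - 1)))
     \<and> 1 / fps_pow1p l (- fps_X) *
         (deg_XD l n (- (deg_log1p l (- fps_X) / (1 - fps_X)))
          + deg_log1p l (- fps_X) * deg_XD l n (1 / (1 - fps_X)))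
       = 1 / (1 - fps_X) * (fps_of_poly (harmonic_fubini l n) oo (fps_X / (1 - fps_X)))"
proof -
  define F where "F = fps_of_poly (harmonic_fubini l n)"
  define z :: "real fps" where "z = fps_X / (1 - fps_X)"
  define L where "L = deg_log1p l (- fps_X)"
  define S where "S = fps_weight (\<lambda>k. deg_falling l (real k) n) (deg_harmonic_gf l)
     + L * fps_weight (\<lambda>k. deg_falling l (real k) n) (1 / (1 - fps_X))"
  define T where "T k = fps_X ^ k * fps_const (deg_falling l (real k) n) *
        (fps_const (deg_harmonic l k) + L)" for k
  have S: "S = fps_pow1p l (- fps_X) * (1 / (1 - fps_X) * (F oo z))"
    unfolding S_def L_def F_def z_def by (rule deg_falling_weight_identity[OF assms])
  have "1 / fps_pow1p l (- fps_X) * S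
      = (fps_pow1p (- l) (- fps_X) * fps_pow1p l (- fps_X)) * (1 / (1 - fps_X) * (F oo z))"
    by (simp add: S fps_pow1p_minus mult.assoc)
  also have "fps_pow1p (- l) (- fps_X) * fps_pow1p l (- fps_X) = 1"
    using fps_pow1p_add[of "- fps_X" "- l" l] by simp
  finally have F1: "1 / fps_pow1p l (- fps_X) * S = 1 / (1 - fps_X) * (F oo z)" by simp
  have T_sums: "T sums S"
    unfolding T_def S_def deg_harmonic_def by (rule sums_fps_weight)

  \<comment> \<open>Substitution by the compositional inverse \<open>g\<close> of \<open>z\<close>.\<close>
  define g :: "real fps" where "g = fps_X / (1 + fps_X)"
  have g0: "g $ 0 = 0" by (simp add: g_def fps_divide_unit)
  have inv: "(1 + fps_X) * inverse (1 + fps_X) = (1 :: real fps)"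
    by (simp add: inverse_mult_eq_1')
  have g1: "- g = 1 / (1 + fps_X) - 1"
    using inv by (simp add: g_def fps_divide_unit algebra_simps)
  have pow_g: "fps_pow1p a (- fps_X) oo g = fps_pow1p (- a) fps_X" for a
    using g0 by (simp add: fps_pow1p_def fps_compose_assoc[symmetric] fps_compose_uminus g1)
      (simp add: fps_pow1p_recip[unfolded fps_pow1p_def])
  have L_g: "L oo g = deg_log1p l (1 / (1 + fps_X) - 1)"
    using g0 by (simp add: L_def deg_log1p_def fps_compose_mult_distrib fps_compose_sub_distrib
        pow_g fps_pow1p_recip)
  have z_g: "z oo g = fps_X"
  proof -
    have "z oo g = g * fps_pow1p 1 fps_X"
      using g0 by (simp add: z_def X_over_one_minus_X fps_compose_mult_distrib pow_g)
    then show ?thesis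
      using inv fps_pow1p_of_nat[of fps_X 1] by (simp add: g_def fps_divide_unit mult_ac)
  qed
  have z0: "z $ 0 = 0" by (simp add: z_def fps_divide_unit)
  have F_z_g: "(F oo z) oo g = F"
    using z0 g0 by (simp add: fps_compose_assoc[symmetric] z_g)
  have T_g: "T k oo g = g ^ k * fps_const (deg_falling l (real k) n) *
        (fps_const (deg_harmonic l k) + deg_log1p l (1 / (1 + fps_X) - 1))" for k
    using g0 by (simp add: T_def fps_compose_mult_distrib fps_compose_add_distrib L_g
        fps_compose_power[symmetric])
  have T_g_sums: "(\<lambda>k. T k oo g) sums (S oo g)"
    using T_sums by (rule sums_fps_compose)
  have "S oo g = fps_pow1p (- l) fps_X * (fps_pow1p 1 fps_X * F)"
    unfolding S one_over_one_minus_X using g0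
    by (simp add: fps_compose_mult_distrib pow_g F_z_g)
  moreover have "fps_pow1p (l - 1) fps_X * (fps_pow1p (- l) fps_X * fps_pow1p 1 fps_X) = 1"
    by (simp add: fps_pow1p_add[symmetric])
  ultimately have F2: "F = fps_pow1p (l - 1) fps_X * (S oo g)"
    by (metis mult.assoc mult_1)

  have F3: "1 / fps_pow1p l (- fps_X) * (deg_XD l n (- (L / (1 - fps_X)))
      + L * deg_XD l n (1 / (1 - fps_X))) = 1 / (1 - fps_X) * (F oo z)"
    unfolding F1[symmetric] by (simp add: S_def deg_XD_eq_weight deg_harmonic_gf_def L_def)

  show ?thesis
    using T_sums T_g_sums F1 F2 F3
    unfolding sums_iff T_g unfolding F_def z_def g_def T_def L_def by auto
qed

end
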